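(* Every countable sectionally complemented modular lattice $L$ has an ($L$-valued) Banaschewski measure on $L$; that is, there exists a map $(x,y)\mapsto y\ominus x$ from $\{(x,y)\in L\times L\mid x\leq y\}$ to $L$ that is isotone in $y$ and antitone in $x$ and such that $y=x\oplus(y\ominus x)$ for all $x\leq y$ in $L$.
   Context: "Countable" means at most countable. In a lattice with zero, $a\oplus b=c$ means $a\wedge b=0$ and $a\vee b=c$. A lattice $L$ with zero is sectionally complemented if for all $a\leq b$ in $L$ there exists $x\in L$ with $b=a\oplus x$. For a subset $X$ of a lattice $L$ with zero, put $X^{[2]}:=\{(x,y)\in X\times X\mid x\leq y\}$; an $L$-valued Banaschewski measure on $X$ is a map $\ominus\colon X^{[2]}\to L$, $(x,y)\mapsto y\ominus x$, isotone (order-preserving) in $y$ and antitone (order-reversing) in $x$, such that $y=x\oplus(y\ominus x)$ for all $x\leq y$ in $X$. *)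

theory Defs
  imports Main "HOL-Library.Countable_Set"
begin

class modular_lattice = lattice +
  assumes modular_law: "x \<le> z \<Longrightarrow> sup x (inf y z) = inf (sup x y) z"

context bounded_lattice_bot
begin

text \<open>The relation \<open>a \<oplus> b = c\<close>; since \<open>\<oplus>\<close> is only a partial operation, it is a ternary predicate.\<close>
definition direct_sum :: "'a \<Rightarrow> 'a \<Rightarrow> 'a \<Rightarrow> bool"
  where "direct_sum a b c \<longleftrightarrow> inf a b = bot \<and> sup a b = c"

end

class sectionally_complemented_lattice = bounded_lattice_bot +
  assumes sectional_complement: "a \<le> b \<Longrightarrow> \<exists>x. direct_sum a x b"

class sectionally_complemented_modular_lattice =
  sectionally_complemented_lattice + modular_lattice

text \<open>
  \<open>D x y\<close> stands for \<open>y \<ominus> x\<close>, so the arguments come in the order of the pair \<open>(x, y)\<close>.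
  Only the values at \<open>x, y \<in> X\<close> with \<open>x \<le> y\<close> are constrained; values elsewhere are irrelevant.
\<close>
definition banaschewski_measure ::
    "'a::bounded_lattice_bot set \<Rightarrow> ('a \<Rightarrow> 'a \<Rightarrow> 'a) \<Rightarrow> bool"
  where "banaschewski_measure X D \<longleftrightarrow>
    (\<forall>x\<in>X. mono_on {y \<in> X. x \<le> y} (\<lambda>y. D x y)) \<and>
    (\<forall>y\<in>X. antimono_on {x \<in> X. x \<le> y} (\<lambda>x. D x y)) \<and>
    (\<forall>x\<in>X. \<forall>y\<in>X. x \<le> y \<longrightarrow> direct_sum x (D x y) y)"

end

theory Submission
  imports Defs
begin

text \<open>
  The model for the construction is Gaussian elimination. Fix an ordered basis
  \<open>e\<^sub>1, \<dots>, e\<^sub>n\<close> of a vector space. The span of those \<open>e\<^sub>i\<close> that do not lie in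
  \<open>X + span(e\<^sub>1, \<dots>, e\<^sub>i\<^sub>-\<^sub>1)\<close> is a complement of the subspace \<open>X\<close>, and it shrinks as \<open>X\<close> grows,
  because fewer indices qualify.

  In a modular lattice, a finite list of elements \<open>e\<^sub>1, \<dots>, e\<^sub>n\<close> takes the place of the basis. It
  does the same for an element \<open>x\<close> as soon as it \<^emph>\<open>decides\<close> \<open>x\<close>: for each \<open>i\<close>, the element \<open>e\<^sub>i\<close> is
  either below or disjoint from \<open>x \<squnion> e\<^sub>1 \<squnion> \<dots> \<squnion> e\<^sub>i\<^sub>-\<^sub>1\<close>. The disjoint entries then join to a
  complement of \<open>x\<close> in \<open>x \<squnion> e\<^sub>1 \<squnion> \<dots> \<squnion> e\<^sub>n\<close> (\<open>direct_sum_pivots\<close>), antitone in \<open>x\<close>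
  (\<open>pivots_antimono\<close>).

  A single finite list need not decide all elements, but any list can be made to decide one more
  element \<open>z\<close>, by splitting each entry \<open>e\<close> into its part below the element that it is compared with
  and a sectional complement of that part (\<open>decides_refine_self\<close>). Such a splitting keeps both
  the property of deciding \<open>x\<close> and the complement already found for \<open>x\<close> (\<open>decides_refine\<close>,
  \<open>pivots_refine\<close>). As there may be no largest element, the join of the list has to grow as
  well; a new entry disjoint from the join of the list, appended at the end, leaves unchanged the
  trace on the old join of the complement of any \<open>x\<close> below that join.

  So run through an enumeration of the lattice, at each step extending and then refining the list.
  For \<open>x \<le> y\<close>, the element \<open>y \<ominus> x\<close> is the meet of \<open>y\<close> with the complement of \<open>x\<close> computed at any
  stage after both have been treated: it does not depend on the stage (\<open>pivots_stage_inf\<close>), and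
  monotonicity can be checked at a common stage.
\<close>

section \<open>Direct sums in modular lattices\<close>

lemma direct_sum_assoc:
  fixes x :: "'a::{bounded_lattice_bot, modular_lattice}"
  assumes "direct_sum x e z" and "direct_sum z s t"
  shows "direct_sum x (sup e s) t"
proof -
  have "inf (sup e s) z = sup e (inf s z)"
    using assms(1) modular_law[of e z s] by (auto simp: direct_sum_def)
  then have "inf (sup e s) z = e"
    using assms(2) by (simp add: direct_sum_def inf_commute)
  then have "inf x (sup e s) = inf x e"
    using assms(1) by (metis direct_sum_def inf.absorb_iff1 inf.commute inf.left_commute sup.cobounded1)
  then show ?thesis
    using assms by (auto simp: direct_sum_def sup_assoc)
qed

lemma direct_sum_commute:
  fixes x :: "'a::bounded_lattice_bot"
  shows "direct_sum x y z \<longleftrightarrow> direct_sum y x z"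
  by (simp add: direct_sum_def inf_commute sup_commute)

lemma direct_sum_inf_right:
  fixes x :: "'a::{bounded_lattice_bot, modular_lattice}"
  assumes "direct_sum x s t" and "x \<le> y" and "y \<le> t"
  shows "direct_sum x (inf y s) y"
proof -
  have "sup x (inf s y) = inf t y"
    using assms(1,2) modular_law[of x y s] by (simp add: direct_sum_def)
  moreover have "inf x (inf y s) = bot"
    using assms(1) by (metis direct_sum_def inf.left_commute inf_bot_right)
  ultimately show ?thesis
    using assms(3) by (simp add: direct_sum_def inf.commute inf.absorb2)
qed

definition relative_complement :: "'a::bounded_lattice_bot \<Rightarrow> 'a \<Rightarrow> 'a"
  where "relative_complement a b = (SOME x. direct_sum a x b)"

lemma direct_sum_relative_complement:
  fixes a :: "'a::sectionally_complemented_lattice"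
  assumes "a \<le> b"
  shows "direct_sum a (relative_complement a b) b"
  unfolding relative_complement_def using sectional_complement[OF assms] by (rule someI_ex)

section \<open>Complements read off from a list\<close>

text \<open>
  In the functions below, \<open>c\<close> accumulates the join of the entries already passed; keeping it as a
  parameter makes the statements provable by induction on the list.
\<close>

definition list_sup :: "'a::bounded_lattice_bot list \<Rightarrow> 'a"
  where "list_sup es = foldr sup es bot"

lemma list_sup_simps [simp]:
  "list_sup [] = bot"
  "list_sup (e # es) = sup e (list_sup es)"
  "list_sup (es @ fs) = sup (list_sup es) (list_sup fs)"
  by (induction es) (simp_all add: list_sup_def sup_assoc)

fun decides :: "'a::bounded_lattice_bot \<Rightarrow> 'a list \<Rightarrow> 'a \<Rightarrow> bool"
  where
    "decides c [] x \<longleftrightarrow> True"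
  | "decides c (e # es) x \<longleftrightarrow>
      (e \<le> sup x c \<or> inf e (sup x c) = bot) \<and> decides (sup c e) es x"

text \<open>
  Only entries disjoint from what precedes them contribute, as in the column-by-column choice of
  pivots in Gaussian elimination.
\<close>

fun pivots :: "'a::bounded_lattice_bot \<Rightarrow> 'a list \<Rightarrow> 'a \<Rightarrow> 'a"
  where
    "pivots c [] x = bot"
  | "pivots c (e # es) x =
      sup (if inf e (sup x c) = bot then e else bot) (pivots (sup c e) es x)"

lemma pivots_le_list_sup: "pivots c es x \<le> list_sup es"
  by (induction es arbitrary: c) (auto intro: le_supI1 le_supI2)

lemma pivots_antimono:
  assumes "x \<le> y"
  shows "pivots c es y \<le> pivots c es x"
proof (induction es arbitrary: c)
  case (Cons e es)
  have "inf e (sup x c) \<le> inf e (sup y c)"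
    using assms by (intro inf_mono sup_mono) auto
  then have "inf e (sup x c) = bot" if "inf e (sup y c) = bot"
    using that by (simp add: bot_unique)
  then show ?case
    using Cons.IH[of "sup c e"] by (auto intro: le_supI1 le_supI2)
qed simp

text \<open>
  Passing an entry \<open>e\<close> either keeps \<open>x \<squnion> c\<close> (when \<open>e\<close> is below it) or replaces it by the direct sum
  with \<open>e\<close>, so that the contributing entries pile up to one big direct sum.
\<close>

lemma direct_sum_pivots:
  fixes x :: "'a::{bounded_lattice_bot, modular_lattice}"
  assumes "decides c es x"
  shows "direct_sum (sup x c) (pivots c es x) (sup (sup x c) (list_sup es))"
  using assms
proof (induction es arbitrary: c)
  case Nil
  then show ?case by (simp add: direct_sum_def)
next
  case (Cons e es)
  have IH: "direct_sum (sup (sup x c) e) (pivots (sup c e) es x)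
      (sup (sup (sup x c) e) (list_sup es))"
    using Cons.IH[of "sup c e"] Cons.prems by (simp add: sup_assoc)
  show ?case
  proof (cases "inf e (sup x c) = bot")
    case True
    then have "direct_sum (sup x c) e (sup (sup x c) e)"
      by (simp add: direct_sum_def inf_commute)
    from direct_sum_assoc[OF this IH] True show ?thesis
      by (simp add: sup_assoc)
  next
    case False
    then have "sup (sup x c) e = sup x c"
      using Cons.prems by (simp add: sup.absorb1)
    then show ?thesis
      using IH False by (simp flip: sup_assoc)
  qed
qed

lemma decides_append:
  "decides c (es @ fs) x \<longleftrightarrow> decides c es x \<and> decides (sup c (list_sup es)) fs x"
  by (induction es arbitrary: c) (auto simp: sup_assoc)

lemma pivots_append:
  "pivots c (es @ fs) x = sup (pivots c es x) (pivots (sup c (list_sup es)) fs x)"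
  by (induction es arbitrary: c) (auto simp: sup_assoc)

section \<open>Refining a list\<close>

fun refine :: "'a::bounded_lattice_bot \<Rightarrow> 'a \<Rightarrow> 'a list \<Rightarrow> 'a list"
  where
    "refine z c [] = []"
  | "refine z c (e # es) =
      (let p = inf e (sup z c) in p # relative_complement p e # refine z (sup c e) es)"

lemma direct_sum_refine:
  fixes e :: "'a::sectionally_complemented_lattice"
  shows "direct_sum (inf e w) (relative_complement (inf e w) e) e"
  by (simp add: direct_sum_relative_complement)

lemma list_sup_refine [simp]:
  fixes z :: "'a::sectionally_complemented_lattice"
  shows "list_sup (refine z c es) = list_sup es"
proof (induction es arbitrary: c)
  case (Cons e es)
  then show ?case
    using direct_sum_refine[of e "sup z c"]
    by (simp add: Let_def direct_sum_def flip: sup_assoc)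
qed simp

text \<open>
  Once the first part \<open>p = e \<sqinter> (z \<squnion> c)\<close> of an entry \<open>e\<close> is passed, \<open>z \<squnion> c\<close> has not changed, and
  the second part of \<open>e\<close> meets it only inside \<open>p\<close>, hence trivially.
\<close>

lemma decides_refine_self:
  fixes z :: "'a::sectionally_complemented_lattice"
  shows "decides c (refine z c es) z"
proof (induction es arbitrary: c)
  case (Cons e es)
  define p where "p = inf e (sup z c)"
  define q where "q = relative_complement p e"
  have pq: "inf p q = bot" "sup p q = e"
    using direct_sum_refine[of e "sup z c"] by (auto simp: p_def q_def direct_sum_def)
  have "sup z (sup c p) = sup z c"
    by (simp add: p_def sup.absorb1 flip: sup_assoc)
  moreover have "inf q (sup z c) = bot"
  proof -
    have "inf q (sup z c) = inf (inf q e) (sup z c)"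
      using pq(2) by (metis inf.absorb1 sup.cobounded2)
    then show ?thesis
      using pq(1) by (simp add: p_def inf_assoc) (simp add: inf_commute inf_left_commute)
  qed
  ultimately have "inf q (sup z (sup c p)) = bot"
    by simp
  moreover have "sup (sup c p) q = sup c e"
    using pq(2) by (simp add: sup_assoc)
  ultimately show ?case
    using Cons.IH by (simp add: Let_def p_def[symmetric] q_def[symmetric]) (simp add: p_def)
qed simp

text \<open>
  Splitting an entry does not change on which side of the dichotomy it falls: an entry below
  \<open>x \<squnion> c\<close> has both parts below it, and if \<open>e = p \<oplus> q\<close> is disjoint from \<open>x \<squnion> c\<close>, then so is \<open>p\<close>, while
  \<open>q\<close> is disjoint even from \<open>x \<squnion> c \<squnion> p\<close> by associativity of direct sums.
\<close>

lemma disjoint_part: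
  fixes w :: "'a::{bounded_lattice_bot, modular_lattice}"
  assumes "direct_sum p q e" and "inf e w = bot"
  shows "inf p w = bot" and "inf q (sup w p) = bot"
proof -
  show "inf p w = bot"
    using assms by (metis bot_unique direct_sum_def inf_mono order_refl sup.cobounded1)
  have "direct_sum q p e" and "direct_sum e w (sup e w)"
    using assms by (auto simp: direct_sum_commute direct_sum_def)
  from direct_sum_assoc[OF this] show "inf q (sup w p) = bot"
    by (simp add: direct_sum_def sup_commute)
qed

lemma decides_refine:
  fixes x :: "'a::sectionally_complemented_modular_lattice"
  assumes "decides c es x"
  shows "decides c (refine z c es) x"
  using assms
proof (induction es arbitrary: c)
  case (Cons e es)
  define p where "p = inf e (sup z c)"
  define q where "q = relative_complement p e"
  have pq: "direct_sum p q e"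
    using direct_sum_refine[of e "sup z c"] by (simp add: p_def q_def)
  then have e: "sup p q = e" "sup (sup c p) q = sup c e"
    by (auto simp: direct_sum_def sup_assoc)
  have "(p \<le> sup x c \<or> inf p (sup x c) = bot) \<and>
      (q \<le> sup x (sup c p) \<or> inf q (sup x (sup c p)) = bot)"
  proof (cases "inf e (sup x c) = bot")
    case True
    from disjoint_part[OF pq True] show ?thesis
      by (simp add: sup_assoc)
  next
    case False
    then have "sup p q \<le> sup x c"
      using Cons.prems e by simp
    then show ?thesis
      by (metis le_supI1 le_supE sup_assoc)
  qed
  then show ?case
    using Cons e by (simp add: Let_def p_def[symmetric] q_def[symmetric])
qed simp

lemma pivots_refine:
  fixes x :: "'a::sectionally_complemented_modular_lattice"
  assumes "decides c es x"
  shows "pivots c (refine z c es) x = pivots c es x"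
  using assms
proof (induction es arbitrary: c)
  case (Cons e es)
  define p where "p = inf e (sup z c)"
  define q where "q = relative_complement p e"
  have pq: "direct_sum p q e"
    using direct_sum_refine[of e "sup z c"] by (simp add: p_def q_def)
  then have e: "sup p q = e" "sup (sup c p) q = sup c e"
    by (auto simp: direct_sum_def sup_assoc)
  have "sup (if inf p (sup x c) = bot then p else bot)
      (if inf q (sup x (sup c p)) = bot then q else bot) =
      (if inf e (sup x c) = bot then e else bot)"
  proof (cases "inf e (sup x c) = bot")
    case True
    from disjoint_part[OF pq True] True e show ?thesis
      by (simp add: sup_assoc)
  next
    case False
    then have "sup p q \<le> sup x c"
      using Cons.prems e by simp
    then have "p \<le> sup x c" and "q \<le> sup x (sup c p)"
      by (auto simp: le_supI1 simp flip: sup_assoc)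
    \<comment> \<open>A part that is both below and disjoint is \<open>bot\<close>, so selecting it has no effect on the join.\<close>
    then have "inf p (sup x c) = p" and "inf q (sup x (sup c p)) = q"
      by (simp_all add: inf.absorb1)
    then show ?thesis
      using False by auto
  qed
  then show ?case
    using Cons e by (simp add: Let_def p_def[symmetric] q_def[symmetric] flip: sup_assoc)
qed simp

section \<open>The sequence of lists along an enumeration\<close>

definition new_entry :: "'a::bounded_lattice_bot list \<Rightarrow> 'a \<Rightarrow> 'a"
  where "new_entry es z = relative_complement (list_sup es) (sup (list_sup es) z)"

fun stage :: "(nat \<Rightarrow> 'a::bounded_lattice_bot) \<Rightarrow> nat \<Rightarrow> 'a list"
  where
    "stage a 0 = []"
  | "stage a (Suc n) = refine (a n) bot (stage a n @ [new_entry (stage a n) (a n)])"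

lemma direct_sum_new_entry:
  fixes z :: "'a::sectionally_complemented_lattice"
  shows "direct_sum (list_sup es) (new_entry es z) (sup (list_sup es) z)"
  by (simp add: new_entry_def direct_sum_relative_complement)

lemma list_sup_stage_Suc:
  fixes a :: "nat \<Rightarrow> 'a::sectionally_complemented_lattice"
  shows "list_sup (stage a (Suc n)) = sup (list_sup (stage a n)) (a n)"
  using direct_sum_new_entry[of "stage a n" "a n"] by (simp add: direct_sum_def)

lemma list_sup_stage_mono:
  fixes a :: "nat \<Rightarrow> 'a::sectionally_complemented_lattice"
  assumes "m \<le> n"
  shows "list_sup (stage a m) \<le> list_sup (stage a n)"
  using assms
  by (rule lift_Suc_mono_le[rotated]) (simp only: list_sup_stage_Suc sup.cobounded1)

lemma le_list_sup_stage:
  fixes a :: "nat \<Rightarrow> 'a::sectionally_complemented_lattice"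
  assumes "k < n"
  shows "a k \<le> list_sup (stage a n)"
proof -
  have "a k \<le> list_sup (stage a (Suc k))"
    by (simp only: list_sup_stage_Suc sup.cobounded2)
  also have "\<dots> \<le> list_sup (stage a n)"
    using assms by (intro list_sup_stage_mono) simp
  finally show ?thesis .
qed

text \<open>An entry disjoint from the whole join so far is a pivot for every element below that join.\<close>

lemma append_new_entry:
  fixes x :: "'a::sectionally_complemented_modular_lattice"
  assumes "decides bot es x" and "x \<le> list_sup es"
  shows "decides bot (es @ [new_entry es z]) x"
    and "pivots bot (es @ [new_entry es z]) x = sup (pivots bot es x) (new_entry es z)"
proof -
  have "inf (new_entry es z) (sup x (list_sup es)) = bot"
    using direct_sum_new_entry[of es z] assms(2)
    by (simp add: direct_sum_def inf_commute sup.absorb2)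
  then show "decides bot (es @ [new_entry es z]) x"
    and "pivots bot (es @ [new_entry es z]) x = sup (pivots bot es x) (new_entry es z)"
    using assms(1) by (simp_all add: decides_append pivots_append)
qed

lemma decides_stage:
  fixes a :: "nat \<Rightarrow> 'a::sectionally_complemented_modular_lattice"
  assumes "k < n"
  shows "decides bot (stage a n) (a k)"
  using assms
proof (induction n)
  case (Suc n)
  show ?case
  proof (cases "k = n")
    case True
    then show ?thesis by (simp add: decides_refine_self)
  next
    case False
    with Suc have "k < n" and "decides bot (stage a n) (a k)"
      by auto
    then show ?thesis
      by (simp add: decides_refine append_new_entry(1) le_list_sup_stage)
  qed
qed simp

lemma direct_sum_pivots_stage:
  fixes a :: "nat \<Rightarrow> 'a::sectionally_complemented_modular_lattice"
  assumes "k < n"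
  shows "direct_sum (a k) (pivots bot (stage a n) (a k)) (list_sup (stage a n))"
  using direct_sum_pivots[OF decides_stage[OF assms, of a]] le_list_sup_stage[OF assms, of a]
  by (simp add: sup.absorb2)

text \<open>
  By modularity, the entry appended at one step contributes nothing below the previous join, and
  the refinement contributes nothing at all.
\<close>

lemma pivots_stage_inf:
  fixes a :: "nat \<Rightarrow> 'a::sectionally_complemented_modular_lattice"
  assumes "k < n" and "n \<le> m" and "y \<le> list_sup (stage a n)"
  shows "inf y (pivots bot (stage a m) (a k)) = inf y (pivots bot (stage a n) (a k))"
  using assms(2)
proof (induction m rule: dec_induct)
  case (step m)
  let ?u = "list_sup (stage a m)" and ?v = "new_entry (stage a m) (a m)"
  let ?s = "pivots bot (stage a m) (a k)"
  have k: "k < m"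
    using assms(1) step.hyps by simp
  have "y \<le> ?u"
    using assms(3) list_sup_stage_mono[OF step.hyps(1), of a] by (rule order_trans)
  have "pivots bot (stage a (Suc m)) (a k) = sup ?s ?v"
    using k by (simp add: pivots_refine append_new_entry decides_stage le_list_sup_stage)
  moreover have "inf (sup ?s ?v) ?u = ?s"
  proof -
    have "inf (sup ?s ?v) ?u = sup ?s (inf ?v ?u)"
      by (rule modular_law[symmetric]) (rule pivots_le_list_sup)
    then show ?thesis
      using direct_sum_new_entry[of "stage a m" "a m"]
      by (simp add: direct_sum_def inf_commute)
  qed
  ultimately have "inf ?u (pivots bot (stage a (Suc m)) (a k)) = ?s"
    by (simp only: inf_commute)
  then have "inf y (inf ?u (pivots bot (stage a (Suc m)) (a k))) = inf y ?s"
    by (simp only:)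
  then have "inf y (pivots bot (stage a (Suc m)) (a k)) = inf y ?s"
    using \<open>y \<le> ?u\<close> by (simp only: inf_assoc[symmetric] inf.absorb1)
  then show ?case
    using step.IH by simp
qed simp

section \<open>The Banaschewski measure\<close>

theorem corollary5p6:
  assumes "countable (UNIV :: 'a::sectionally_complemented_modular_lattice set)"
  shows "\<exists>D :: 'a \<Rightarrow> 'a \<Rightarrow> 'a. banaschewski_measure UNIV D"
proof -
  define a :: "nat \<Rightarrow> 'a" where "a = from_nat_into UNIV"
  define i :: "'a \<Rightarrow> nat" where "i = to_nat_on UNIV"
  have a_i [simp]: "a (i x) = x" for x
    unfolding a_def i_def using assms by simp
  define C where "C n x = pivots bot (stage a n) x" for n and x :: 'a
  define D where "D x y = inf y (C (Suc (max (i x) (i y))) x)" for x y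
  have below: "x \<le> list_sup (stage a n)" if "i x < n" for x n
    using le_list_sup_stage[OF that, of a] by simp
  have D_eq: "D x y = inf y (C n x)" if "i x < n" and "i y < n" for x y n
    unfolding D_def C_def
    using pivots_stage_inf[of "i x" "Suc (max (i x) (i y))" n y a] that
    by (simp add: below del: stage.simps)
  have "direct_sum x (D x y) y" if "x \<le> y" for x y
    unfolding D_def C_def
    using direct_sum_pivots_stage[of "i x" "Suc (max (i x) (i y))" a] that
    by (intro direct_sum_inf_right[where t = "list_sup (stage a (Suc (max (i x) (i y))))"])
      (simp_all add: below del: stage.simps)
  moreover have "D x y \<le> D x z" if "y \<le> z" for x y z
  proof -
    define n where "n = Suc (max (i x) (max (i y) (i z)))"
    have "i x < n" "i y < n" "i z < n"
      by (auto simp: n_def)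
    then show ?thesis
      using inf_mono[OF that order_refl] by (simp add: D_eq)
  qed
  moreover have "D y z \<le> D x z" if "x \<le> y" for x y z
  proof -
    define n where "n = Suc (max (i x) (max (i y) (i z)))"
    have "i x < n" "i y < n" "i z < n"
      by (auto simp: n_def)
    then show ?thesis
      using inf_mono[OF order_refl pivots_antimono[OF that]] by (simp add: D_eq C_def)
  qed
  ultimately have "banaschewski_measure UNIV D"
    unfolding banaschewski_measure_def by (auto intro!: monotone_onI)
  then show ?thesis
    by blast
qed

end
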